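(* For every field $F$ there exist vector spaces $U$ and $V$ over $F$ and a mapping $\varphi\colon U\to V$ that is $F$-homogeneous but not additive.
   Context: For vector spaces $U$, $V$ over a field $F$, a mapping $\varphi\colon U\to V$ is called additive if $\varphi(u_1+u_2)=\varphi(u_1)+\varphi(u_2)$ for all $u_1,u_2\in U$; it is called $F$-homogeneous if $\varphi(\lambda u)=\lambda\varphi(u)$ for every $u\in U$ and every $\lambda\in F$ (including $\lambda=0$). *)

theory Defs
  imports "HOL-Algebra.Module"
begin

locale vectorspace_over = field F + module F V for F (structure) and V (structure)

definition additive_map ::
    "('a, 'u, 'm) module_scheme \<Rightarrow> ('a, 'v, 'n) module_scheme \<Rightarrow> ('u \<Rightarrow> 'v) \<Rightarrow> bool" where
  "additive_map U V \<phi> \<longleftrightarrow>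
     (\<forall>u\<^sub>1 \<in> carrier U. \<forall>u\<^sub>2 \<in> carrier U. \<phi> (u\<^sub>1 \<oplus>\<^bsub>U\<^esub> u\<^sub>2) = \<phi> u\<^sub>1 \<oplus>\<^bsub>V\<^esub> \<phi> u\<^sub>2)"

definition homogeneous_map ::
    "('a, 'k) ring_scheme \<Rightarrow> ('a, 'u, 'm) module_scheme \<Rightarrow> ('a, 'v, 'n) module_scheme \<Rightarrow>
     ('u \<Rightarrow> 'v) \<Rightarrow> bool" where
  "homogeneous_map F U V \<phi> \<longleftrightarrow>
     (\<forall>u \<in> carrier U. \<forall>l \<in> carrier F. \<phi> (l \<odot>\<^bsub>U\<^esub> u) = l \<odot>\<^bsub>V\<^esub> \<phi> u)"

(* HOL cannot quantify existentially over types, so an existence claim about vector spaces over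
   F has to fix a type for their elements.  Sequences over the element type of F are large
   enough for a copy of every vector space over F of countable dimension; carrier, addition,
   zero and scalar multiplication remain existentially quantified. *)
type_synonym 'a vspace = "('a, nat \<Rightarrow> 'a) module"

end

theory Submission
  imports Defs
begin

text \<open>
  Homogeneity relates values of a map only along a single line through the origin, so
  different lines may be treated independently; additivity fails as soon as the choices on different
  lines do not fit together. Over every field, including the one with two elements, this can be
  realised in the space of all sequences by the map that keeps \<open>u\<close> if \<open>u 0 \<noteq> 0\<close> and sends it to
  zero otherwise. Scaling by a nonzero \<open>l\<close> does not change whether \<open>u 0\<close> vanishes, because a
  field has no zero divisors, and scaling by \<open>l = 0\<close> gives zero on both sides. With the unit
  sequences \<open>e\<^sub>0\<close> and \<open>e\<^sub>1\<close>, however, the map sends \<open>e\<^sub>0 + e\<^sub>1\<close> to itself, while it sends \<open>e\<^sub>0\<close> to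
  \<open>e\<^sub>0\<close> and \<open>e\<^sub>1\<close> to zero.
\<close>

text \<open>The type of modules extends that of rings, so this is the product of copies of the ring
  indexed by the natural numbers, with its ring operations as well as its scalar multiplication.\<close>

definition sequence_space :: "('a, 'k) ring_scheme \<Rightarrow> 'a vspace" where
  "sequence_space F =
     \<lparr>carrier = {u. \<forall>n. u n \<in> carrier F},
      mult = (\<lambda>u v n. u n \<otimes>\<^bsub>F\<^esub> v n), one = (\<lambda>n. \<one>\<^bsub>F\<^esub>),
      zero = (\<lambda>n. \<zero>\<^bsub>F\<^esub>), add = (\<lambda>u v n. u n \<oplus>\<^bsub>F\<^esub> v n),
      smult = (\<lambda>l u n. l \<otimes>\<^bsub>F\<^esub> u n)\<rparr>"

lemma sequence_space_simps [simp]: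
  "u \<in> carrier (sequence_space F) \<longleftrightarrow> (\<forall>n. u n \<in> carrier F)"
  "\<zero>\<^bsub>sequence_space F\<^esub> = (\<lambda>n. \<zero>\<^bsub>F\<^esub>)"
  "u \<oplus>\<^bsub>sequence_space F\<^esub> v = (\<lambda>n. u n \<oplus>\<^bsub>F\<^esub> v n)"
  "l \<odot>\<^bsub>sequence_space F\<^esub> u = (\<lambda>n. l \<otimes>\<^bsub>F\<^esub> u n)"
  by (simp_all add: sequence_space_def)

lemma (in cring) module_sequence_space: "module R (sequence_space R)"
proof (rule moduleI)
  show "abelian_group (sequence_space R)"
  proof (rule abelian_groupI)
    fix u assume "u \<in> carrier (sequence_space R)"
    then show "\<exists>v \<in> carrier (sequence_space R). v \<oplus>\<^bsub>sequence_space R\<^esub> u = \<zero>\<^bsub>sequence_space R\<^esub>"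
      by (intro bexI [of _ "\<lambda>n. \<ominus> u n"]) (auto simp: l_neg)
  qed (auto simp: a_ac)
qed (auto simp: is_cring l_distr r_distr m_assoc)

lemma vectorspace_sequence_space:
  assumes "field F"
  shows "vectorspace_over F (sequence_space F)"
  using assms by (simp add: vectorspace_over_def cring.module_sequence_space fieldE(1))

definition vanish_if_head_zero ::
    "('a, 'k) ring_scheme \<Rightarrow> (nat \<Rightarrow> 'a) \<Rightarrow> nat \<Rightarrow> 'a" where
  "vanish_if_head_zero F u = (if u 0 = \<zero>\<^bsub>F\<^esub> then (\<lambda>n. \<zero>\<^bsub>F\<^esub>) else u)"

lemma (in domain) homogeneous_vanish_if_head_zero:
  "homogeneous_map R (sequence_space R) (sequence_space R) (vanish_if_head_zero R)"
  unfolding homogeneous_map_def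
proof (intro ballI)
  fix u l assume "u \<in> carrier (sequence_space R)" and l: "l \<in> carrier R"
  then have u: "u n \<in> carrier R" for n
    by simp
  have "l \<otimes> u 0 = \<zero> \<longleftrightarrow> l = \<zero> \<or> u 0 = \<zero>"
    using integral_iff l u by blast
  then show "vanish_if_head_zero R (l \<odot>\<^bsub>sequence_space R\<^esub> u) =
      l \<odot>\<^bsub>sequence_space R\<^esub> vanish_if_head_zero R u"
    using l u by (auto simp: vanish_if_head_zero_def)
qed

lemma (in domain) not_additive_vanish_if_head_zero:
  "\<not> additive_map (sequence_space R) (sequence_space R) (vanish_if_head_zero R)"
proof
  let ?e = "\<lambda>i n. if n = i then \<one> else \<zero>"
  assume "additive_map (sequence_space R) (sequence_space R) (vanish_if_head_zero R)"
  then have "vanish_if_head_zero R (?e 0 \<oplus>\<^bsub>sequence_space R\<^esub> ?e 1) =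
      vanish_if_head_zero R (?e 0) \<oplus>\<^bsub>sequence_space R\<^esub> vanish_if_head_zero R (?e 1)"
    unfolding additive_map_def by (elim ballE) (auto split: if_splits)
  \<comment> \<open>The two sides differ at index 1, where they are \<open>\<one>\<close> and \<open>\<zero>\<close>.\<close>
  then have "vanish_if_head_zero R (?e 0 \<oplus>\<^bsub>sequence_space R\<^esub> ?e 1) 1 =
      (vanish_if_head_zero R (?e 0) \<oplus>\<^bsub>sequence_space R\<^esub> vanish_if_head_zero R (?e 1)) 1"
    by (rule fun_cong)
  then show False
    by (simp add: vanish_if_head_zero_def)
qed

theorem theorem2p2:
  fixes F :: "('a, 'k) ring_scheme"
  assumes "field F"
  shows "\<exists>(U :: 'a vspace) (V :: 'a vspace) \<phi>.
           vectorspace_over F U \<and> vectorspace_over F V \<and>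
           \<phi> \<in> carrier U \<rightarrow> carrier V \<and>
           homogeneous_map F U V \<phi> \<and> \<not> additive_map U V \<phi>"
proof (intro exI conjI)
  interpret field F by fact
  show "vectorspace_over F (sequence_space F)" "vectorspace_over F (sequence_space F)"
    by (rule vectorspace_sequence_space [OF assms])+
  show "vanish_if_head_zero F \<in> carrier (sequence_space F) \<rightarrow> carrier (sequence_space F)"
    by (auto simp: vanish_if_head_zero_def)
  show "homogeneous_map F (sequence_space F) (sequence_space F) (vanish_if_head_zero F)"
    by (rule homogeneous_vanish_if_head_zero)
  show "\<not> additive_map (sequence_space F) (sequence_space F) (vanish_if_head_zero F)"
    by (rule not_additive_vanish_if_head_zero)
qed

end
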